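(* Let $n \geq 1$ be an integer, and let $\mathcal{S}_{2n}$ be the set of all symplectically self-polar convex bodies $X \subset \mathbb{R}^{2n}$, equipped with the topology induced by the Hausdorff distance. Then the topological space $\mathcal{S}_{2n}$ is contractible.
   Context: Let $\omega$ be the standard symplectic form on $\mathbb{R}^{2n}$, i.e. in coordinates $(q_1,\dots,q_n,p_1,\dots,p_n)$, $\omega\big((q,p),(q',p')\big) = \sum_{i=1}^n (q_i p_i' - p_i q_i')$. A convex body is a compact convex set with nonempty interior. For a convex body $X \subset \mathbb{R}^{2n}$ with the origin in its interior, its symplectic polar is \[ X^\omega = \{ y \in \mathbb{R}^{2n} \mid \omega(x,y) \leq 1 \text{ for all } x \in X \}. \] A convex body $X \subset \mathbb{R}^{2n}$ with the origin in its interior is called symplectically self-polar if $X = X^\omega$. The Hausdorff distance is taken with respect to the Euclidean metric on $\mathbb{R}^{2n}$. *)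

theory Defs
  imports "HOL-Analysis.Analysis"
begin

text \<open>The space of dimension 2n is \<open>(real^'n) \<times> (real^'n)\<close> with \<open>n = CARD('n)\<close>; a point is the pair
  \<open>(q, p)\<close>. The library's metric on this product is the Euclidean one.\<close>

definition symplectic_form :: "(real^'n) \<times> (real^'n) \<Rightarrow> (real^'n) \<times> (real^'n) \<Rightarrow> real" where
  "symplectic_form = (\<lambda>(q, p) (q', p'). \<Sum>i\<in>UNIV. q $ i * p' $ i - p $ i * q' $ i)"

definition convex_body :: "'a::euclidean_space set \<Rightarrow> bool" where
  "convex_body X \<longleftrightarrow> compact X \<and> convex X \<and> interior X \<noteq> {}"

definition symplectic_polar :: "((real^'n) \<times> (real^'n)) set \<Rightarrow> ((real^'n) \<times> (real^'n)) set" where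
  "symplectic_polar X = {y. \<forall>x\<in>X. symplectic_form x y \<le> 1}"

definition symplectically_self_polar :: "((real^'n) \<times> (real^'n)) set \<Rightarrow> bool" where
  "symplectically_self_polar X \<longleftrightarrow> convex_body X \<and> 0 \<in> interior X \<and> X = symplectic_polar X"

text \<open>The locale \<open>Metric_space\<close> demands nonnegativity and symmetry on the whole type, hence
  the default value 0 where the suprema are not meaningful.\<close>

definition hausdorff_distance :: "'a::metric_space set \<Rightarrow> 'a set \<Rightarrow> real" where
  "hausdorff_distance A B =
     (if A \<noteq> {} \<and> B \<noteq> {} \<and> bounded A \<and> bounded B
      then max (SUP a\<in>A. infdist a B) (SUP b\<in>B. infdist b A) else 0)"

definition self_polar_bodies :: "((real^'n) \<times> (real^'n)) set set" where
  "self_polar_bodies = {X. symplectically_self_polar X}"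

definition self_polar_space :: "((real^'n) \<times> (real^'n)) set topology" where
  "self_polar_space = Metric_space.mtopology self_polar_bodies hausdorff_distance"

lemma bdd_above_infdist_image:
  assumes "bounded A"
  shows "bdd_above ((\<lambda>a. infdist a B) ` A)"
proof (cases "B = {}")
  case True
  then show ?thesis by (auto simp: infdist_def intro!: bdd_aboveI[of _ 0])
next
  case False
  then obtain b where b: "b \<in> B" by blast
  obtain e where "\<forall>a\<in>A. dist b a \<le> e"
    using assms bounded_any_center by blast
  then have "\<forall>a\<in>A. infdist a B \<le> e"
    using infdist_le[OF b] by (metis dist_commute order_trans)
  then show ?thesis by (auto intro!: bdd_aboveI[of _ e])
qed

lemma infdist_le_hausdorff_distance:
  assumes "bounded A" "bounded B" "B \<noteq> {}" "a \<in> A"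
  shows "infdist a B \<le> hausdorff_distance A B"
proof -
  have "infdist a B \<le> (SUP a\<in>A. infdist a B)"
    using assms by (intro cSUP_upper bdd_above_infdist_image)
  then show ?thesis using assms by (auto simp: hausdorff_distance_def)
qed

lemma hausdorff_distance_commute: "hausdorff_distance A B = hausdorff_distance B A"
  by (auto simp: hausdorff_distance_def max.commute)

lemma hausdorff_distance_nonneg: "0 \<le> hausdorff_distance A B"
proof (cases "A \<noteq> {} \<and> B \<noteq> {} \<and> bounded A \<and> bounded B")
  case True
  then obtain a where "a \<in> A" by blast
  with True show ?thesis
    using infdist_le_hausdorff_distance[of A B a] infdist_nonneg[of a B] by linarith
next
  case False
  then show ?thesis by (auto simp: hausdorff_distance_def)
qed

lemma hausdorff_distance_le:
  assumes "A \<noteq> {}" "B \<noteq> {}" "0 \<le> r"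
    "\<And>a. a \<in> A \<Longrightarrow> infdist a B \<le> r" "\<And>b. b \<in> B \<Longrightarrow> infdist b A \<le> r"
  shows "hausdorff_distance A B \<le> r"
  using assms by (auto simp: hausdorff_distance_def intro!: cSUP_least)

lemma infdist_triangle_hausdorff_distance:
  fixes A B C :: "'a::heine_borel set"
  assumes "bounded A" "compact B" "bounded C" "B \<noteq> {}" "C \<noteq> {}" "a \<in> A"
  shows "infdist a C \<le> hausdorff_distance A B + hausdorff_distance B C"
proof -
  obtain b where b: "b \<in> B" "infdist a B = dist a b"
    using assms infdist_attains_inf compact_imp_closed by metis
  have "infdist a C \<le> infdist b C + dist a b" by (rule infdist_triangle)
  also have "\<dots> \<le> hausdorff_distance B C + hausdorff_distance A B"
    using infdist_le_hausdorff_distance[of A B a] infdist_le_hausdorff_distance[of B C b] b assms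
    by (simp add: compact_imp_bounded)
  finally show ?thesis by simp
qed

lemma Metric_space_hausdorff_distance:
  "Metric_space {X :: 'a::heine_borel set. compact X \<and> X \<noteq> {}} hausdorff_distance"
proof
  fix A B C :: "'a set"
  show "0 \<le> hausdorff_distance A B" by (rule hausdorff_distance_nonneg)
  show "hausdorff_distance A B = hausdorff_distance B A" by (rule hausdorff_distance_commute)
  assume "A \<in> {X. compact X \<and> X \<noteq> {}}" "B \<in> {X. compact X \<and> X \<noteq> {}}"
  then have AB: "compact A" "A \<noteq> {}" "compact B" "B \<noteq> {}" by auto
  show "hausdorff_distance A B = 0 \<longleftrightarrow> A = B"
  proof
    assume 0: "hausdorff_distance A B = 0"
    have sub: "X \<subseteq> Y" if "compact X" "compact Y" "Y \<noteq> {}" "hausdorff_distance X Y = 0"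
      for X Y :: "'a set"
    proof
      fix x assume "x \<in> X"
      then have "infdist x Y \<le> 0"
        using infdist_le_hausdorff_distance[of X Y x] that by (simp add: compact_imp_bounded)
      then have "infdist x Y = 0" using infdist_nonneg[of x Y] by linarith
      then show "x \<in> Y"
        using in_closed_iff_infdist_zero that compact_imp_closed by metis
    qed
    show "A = B"
      using sub[of A B] sub[of B A] AB 0 by (simp add: hausdorff_distance_commute subset_antisym)
  next
    assume "A = B"
    then have "hausdorff_distance A B \<le> 0"
      using AB by (intro hausdorff_distance_le) auto
    then show "hausdorff_distance A B = 0" using hausdorff_distance_nonneg[of A B] by linarith
  qed
  assume "C \<in> {X. compact X \<and> X \<noteq> {}}"
  then have C: "compact C" "C \<noteq> {}" by auto
  show "hausdorff_distance A C \<le> hausdorff_distance A B + hausdorff_distance B C"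
  proof (rule hausdorff_distance_le)
    show "0 \<le> hausdorff_distance A B + hausdorff_distance B C"
      by (simp add: hausdorff_distance_nonneg)
    show "infdist a C \<le> hausdorff_distance A B + hausdorff_distance B C" if "a \<in> A" for a
      using infdist_triangle_hausdorff_distance[of A B C a] AB C that
      by (simp add: compact_imp_bounded)
    show "infdist c A \<le> hausdorff_distance A B + hausdorff_distance B C" if "c \<in> C" for c
      using infdist_triangle_hausdorff_distance[of C B A c] AB C that
      by (simp add: compact_imp_bounded hausdorff_distance_commute add.commute)
  qed (use AB C in auto)
qed

lemma Metric_space_self_polar_bodies:
  "Metric_space (self_polar_bodies :: ((real^'n) \<times> (real^'n)) set set) hausdorff_distance"
  by (rule Metric_space.subspace[OF Metric_space_hausdorff_distance])
    (auto simp: self_polar_bodies_def symplectically_self_polar_def convex_body_def)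

lemma topspace_self_polar_space: "topspace self_polar_space = self_polar_bodies"
  unfolding self_polar_space_def
  by (rule Metric_space.topspace_mtopology[OF Metric_space_self_polar_bodies])

end

theory Submission
  imports Defs
begin

text \<open>A self-polar body is the unit ball \<open>{p \<le> 1}\<close> of a norm \<open>p\<close> equal to its symplectic dual
  \<open>p\<^sup>*(y) = sup\<^sub>x \<omega>(x, y) / p(x)\<close>. For every even gauge \<open>p\<close> the mean \<open>m = (p + p\<^sup>*) / 2\<close> satisfies
  \<open>m\<^sup>* \<le> m\<close>, so iterating \<open>p \<mapsto> (p + p\<^sup>*) / 2\<close> gives a decreasing sequence, and its limit \<open>G p\<close> is
  self-dual. Duality is compatible with multiplicative bounds: \<open>p \<le> \<lambda> q\<close> and \<open>q \<le> \<lambda> p\<close> imply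
  \<open>G p \<le> \<lambda> G q\<close>. Hence \<open>G\<close> is continuous, and
  \<open>(t, p) \<mapsto> G ((1 - t) p + t \<bar>\<cdot>\<bar>)\<close> contracts the self-dual norms to the Euclidean norm.\<close>

subsection \<open>The symplectic form\<close>

text \<open>Multiplication by the imaginary unit under \<open>q + i p\<close>; it turns the form
  into the Euclidean inner product, so Cauchy-Schwarz and halfspaces become available.\<close>

definition symplectic_rotation :: "(real^'n) \<times> (real^'n) \<Rightarrow> (real^'n) \<times> (real^'n)" where
  "symplectic_rotation z = (- snd z, fst z)"

lemma symplectic_form_eq_inner: "symplectic_form x y = symplectic_rotation x \<bullet> y"
  by (cases x; cases y)
    (simp add: symplectic_form_def symplectic_rotation_def inner_vec_def
      sum_subtractf sum_negf algebra_simps)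

lemma norm_symplectic_rotation [simp]: "norm (symplectic_rotation x) = norm x"
  by (cases x) (simp add: symplectic_rotation_def norm_Pair add.commute)

lemma symplectic_form_scale_left: "symplectic_form (a *\<^sub>R x) y = a * symplectic_form x y"
  by (simp add: symplectic_form_eq_inner symplectic_rotation_def inner_prod_def algebra_simps)

lemma symplectic_form_scale_right: "symplectic_form x (a *\<^sub>R y) = a * symplectic_form x y"
  by (simp add: symplectic_form_eq_inner)

lemma symplectic_form_diff_left:
  "symplectic_form (x - x') y = symplectic_form x y - symplectic_form x' y"
  by (simp add: symplectic_form_eq_inner symplectic_rotation_def inner_prod_def algebra_simps)

lemma symplectic_form_skew: "symplectic_form x y = - symplectic_form y x"
  by (simp add: symplectic_form_eq_inner symplectic_rotation_def inner_prod_def inner_commute)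

lemma symplectic_form_zero [simp]: "symplectic_form 0 y = 0" "symplectic_form x 0 = 0"
  by (simp_all add: symplectic_form_eq_inner symplectic_rotation_def flip: zero_prod_def)

lemma symplectic_form_le_norm: "symplectic_form x y \<le> norm x * norm y"
  using norm_cauchy_schwarz[of "symplectic_rotation x" y] by (simp add: symplectic_form_eq_inner)

text \<open>The equality case of Cauchy-Schwarz: rotating twice gives \<open>- y\<close>, so the
  negative of the rotated \<open>y\<close> pairs with \<open>y\<close> to its squared norm.\<close>

lemma symplectic_form_attains_norm:
  obtains x where "norm x = norm y" "symplectic_form x y = norm y * norm y"
proof
  show "norm (- symplectic_rotation y) = norm y" by simp
  show "symplectic_form (- symplectic_rotation y) y = norm y * norm y"
    by (simp add: symplectic_form_eq_inner symplectic_rotation_def inner_prod_def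
        dot_square_norm[symmetric] flip: power2_eq_square)
qed

subsection \<open>Gauges and their symplectic duals\<close>

text \<open>Subadditivity is not demanded: every self-dual gauge has it, being a supremum of linear forms.\<close>

definition even_gauge :: "('a::real_normed_vector \<Rightarrow> real) \<Rightarrow> bool" where
  "even_gauge p \<longleftrightarrow> (\<forall>a x. p (a *\<^sub>R x) = \<bar>a\<bar> * p x) \<and>
     (\<exists>c>0. \<forall>x. c * norm x \<le> p x) \<and> (\<exists>C>0. \<forall>x. p x \<le> C * norm x)"

text \<open>At \<open>x = 0\<close> the quotient is \<open>0 / 0 = 0\<close>, which does not affect the supremum.\<close>

definition dual_gauge ::
  "((real^'n) \<times> (real^'n) \<Rightarrow> real) \<Rightarrow> (real^'n) \<times> (real^'n) \<Rightarrow> real" where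
  "dual_gauge p y = (SUP x. symplectic_form x y / p x)"

definition self_dual_gauge :: "((real^'n) \<times> (real^'n) \<Rightarrow> real) \<Rightarrow> bool" where
  "self_dual_gauge p \<longleftrightarrow> even_gauge p \<and> dual_gauge p = p"

lemma even_gaugeI:
  assumes "\<And>a x. p (a *\<^sub>R x) = \<bar>a\<bar> * p x" "c > 0" "\<And>x. c * norm x \<le> p x"
    "C > 0" "\<And>x. p x \<le> C * norm x"
  shows "even_gauge p"
  using assms unfolding even_gauge_def by blast

lemma even_gauge_scale: "even_gauge p \<Longrightarrow> p (a *\<^sub>R x) = \<bar>a\<bar> * p x"
  by (simp add: even_gauge_def)

lemma even_gauge_zero: "even_gauge p \<Longrightarrow> p 0 = 0"
  using even_gauge_scale[of p 0 0] by simp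

lemma even_gauge_minus: "even_gauge p \<Longrightarrow> p (- x) = p x"
  using even_gauge_scale[of p "-1" x] by simp

lemma even_gauge_lower: "even_gauge p \<Longrightarrow> \<exists>c>0. \<forall>x. c * norm x \<le> p x"
  by (simp add: even_gauge_def)

lemma even_gauge_upper: "even_gauge p \<Longrightarrow> \<exists>C>0. \<forall>x. p x \<le> C * norm x"
  by (simp add: even_gauge_def)

lemma even_gauge_pos:
  assumes "even_gauge p" "x \<noteq> 0"
  shows "p x > 0"
proof -
  obtain c where "c > 0" "\<forall>x. c * norm x \<le> p x" using even_gauge_lower assms by blast
  moreover have "c * norm x > 0" using \<open>c > 0\<close> assms by simp
  ultimately show ?thesis by (meson less_le_trans)
qed

lemma even_gauge_nonneg: "even_gauge p \<Longrightarrow> p x \<ge> 0"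
  using even_gauge_pos[of p x] even_gauge_zero[of p] by (cases "x = 0") auto

lemma even_gauge_norm: "even_gauge norm"
  by (rule even_gaugeI[where c=1 and C=1]) auto

lemma even_gauge_add:
  assumes "even_gauge p" "even_gauge q"
  shows "even_gauge (\<lambda>x. p x + q x)"
proof -
  obtain c C where c: "c > 0" "C > 0" "\<And>x. c * norm x \<le> p x" "\<And>x. p x \<le> C * norm x"
    using assms(1) unfolding even_gauge_def by blast
  obtain d D where d: "d > 0" "D > 0" "\<And>x. d * norm x \<le> q x" "\<And>x. q x \<le> D * norm x"
    using assms(2) unfolding even_gauge_def by blast
  show ?thesis
  proof (rule even_gaugeI[where c="c+d" and C="C+D"])
    show "(c + d) * norm x \<le> p x + q x" for x
      using c(3)[of x] d(3)[of x] by (simp add: algebra_simps)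
    show "p x + q x \<le> (C + D) * norm x" for x
      using c(4)[of x] d(4)[of x] by (simp add: algebra_simps)
  qed (use c d assms in \<open>auto simp: even_gauge_scale algebra_simps\<close>)
qed

lemma even_gauge_cmult:
  assumes "even_gauge p" "s > 0"
  shows "even_gauge (\<lambda>x. s * p x)"
proof -
  obtain c C where c: "c > 0" "C > 0" "\<And>x. c * norm x \<le> p x" "\<And>x. p x \<le> C * norm x"
    using assms(1) unfolding even_gauge_def by blast
  show ?thesis
    by (rule even_gaugeI[where c="s*c" and C="s*C"])
      (use c assms in \<open>auto simp: even_gauge_scale mult.assoc\<close>)
qed

text \<open>The lower bound \<open>c * norm x \<le> p x\<close> keeps the quotients below
  \<open>norm y / c\<close>, so the supremum is a genuine one. The term at \<open>x = 0\<close>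
  makes it nonnegative.\<close>

lemma
  assumes "even_gauge p"
  shows symplectic_form_le_dual_gauge: "symplectic_form x y \<le> p x * dual_gauge p y"
    and dual_gauge_nonneg: "0 \<le> dual_gauge p y"
proof -
  obtain c where c: "c > 0" "\<And>x. c * norm x \<le> p x" using even_gauge_lower assms by blast
  have "symplectic_form x y / p x \<le> norm y / c" for x
  proof (cases "x = 0")
    case False
    have "symplectic_form x y * c \<le> (norm x * norm y) * c"
      using c(1) by (intro mult_right_mono symplectic_form_le_norm) auto
    also have "\<dots> \<le> norm y * p x"
      using mult_left_mono[OF c(2)[of x], of "norm y"] by (simp add: algebra_simps)
    finally show ?thesis using even_gauge_pos[OF assms False] c by (simp add: field_simps)
  qed (use c in simp)
  then have bdd: "bdd_above (range (\<lambda>x. symplectic_form x y / p x))"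
    by (auto intro!: bdd_aboveI)
  then have up: "symplectic_form x y / p x \<le> dual_gauge p y" for x
    unfolding dual_gauge_def by (intro cSUP_upper) auto
  show "symplectic_form x y \<le> p x * dual_gauge p y"
    using up[of x] even_gauge_pos[OF assms, of x] even_gauge_zero[OF assms]
    by (cases "x = 0") (auto simp: field_simps)
  show "0 \<le> dual_gauge p y" using up[of 0] by simp
qed

text \<open>With \<open>symplectic_form_le_dual_gauge\<close> this characterises the dual at
  \<open>y\<close> as the least \<open>r \<ge> 0\<close> with
  \<open>symplectic_form x y \<le> p x * r\<close> for all \<open>x\<close>. Duality is used only in
  this form below.\<close>

lemma dual_gauge_le:
  assumes "even_gauge p" "0 \<le> r" "\<And>x. symplectic_form x y \<le> p x * r"
  shows "dual_gauge p y \<le> r"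
  unfolding dual_gauge_def
proof (rule cSUP_least)
  show "symplectic_form x y / p x \<le> r" for x
    using assms even_gauge_pos[of p x] by (cases "x = 0") (auto simp: field_simps)
qed simp

text \<open>The factor \<open>l\<close> passes from the gauge to its dual inside the product
  \<open>p x * dual_gauge p y\<close>. The case \<open>l = 1\<close> is order reversal; general
  \<open>l\<close> carries the multiplicative comparison.\<close>

lemma dual_gauge_antimono:
  assumes "even_gauge p" "even_gauge q" "\<And>x. p x \<le> l * q x" "0 \<le> l"
  shows "dual_gauge q y \<le> l * dual_gauge p y"
proof (rule dual_gauge_le)
  fix x
  have "symplectic_form x y \<le> p x * dual_gauge p y"
    by (rule symplectic_form_le_dual_gauge[OF assms(1)])
  also have "\<dots> \<le> (l * q x) * dual_gauge p y"
    by (intro mult_right_mono assms dual_gauge_nonneg)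
  finally show "symplectic_form x y \<le> q x * (l * dual_gauge p y)" by (simp add: algebra_simps)
qed (intro assms mult_nonneg_nonneg dual_gauge_nonneg)+

lemma dual_gauge_norm: "dual_gauge norm = norm"
proof
  fix y :: "(real^'n) \<times> (real^'n)"
  obtain x where x: "norm x = norm y" "symplectic_form x y = norm y * norm y"
    by (rule symplectic_form_attains_norm)
  have "norm y * norm y \<le> norm y * dual_gauge norm y"
    using symplectic_form_le_dual_gauge[OF even_gauge_norm, of x y] x by simp
  then have "norm y \<le> dual_gauge norm y"
    using dual_gauge_nonneg[OF even_gauge_norm, of y]
    by (cases "y = 0") auto
  moreover have "dual_gauge norm y \<le> norm y"
    by (intro dual_gauge_le even_gauge_norm symplectic_form_le_norm) auto
  ultimately show "dual_gauge norm y = norm y" by simp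
qed

text \<open>Since the norm is its own dual, \<open>c * norm \<le> p \<le> C * norm\<close> dualises
  to bounds with \<open>1 / C\<close> and \<open>1 / c\<close>. Homogeneity comes from moving the
  scalar to the other argument of the form; one inequality suffices, because scaling back by the
  inverse gives the other.\<close>

lemma even_gauge_dual_gauge:
  assumes "even_gauge p"
  shows "even_gauge (dual_gauge p)"
proof -
  obtain c C where c: "c > 0" "C > 0" "\<And>x. c * norm x \<le> p x" "\<And>x. p x \<le> C * norm x"
    using assms unfolding even_gauge_def by blast
  have le: "dual_gauge p (a *\<^sub>R y) \<le> \<bar>a\<bar> * dual_gauge p y" for a y
  proof (rule dual_gauge_le[OF assms])
    fix x
    have "symplectic_form x (a *\<^sub>R y) = symplectic_form (a *\<^sub>R x) y"
      by (simp add: symplectic_form_scale_left symplectic_form_scale_right)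
    also have "\<dots> \<le> p (a *\<^sub>R x) * dual_gauge p y"
      by (rule symplectic_form_le_dual_gauge[OF assms])
    finally show "symplectic_form x (a *\<^sub>R y) \<le> p x * (\<bar>a\<bar> * dual_gauge p y)"
      by (simp add: even_gauge_scale[OF assms] algebra_simps)
  qed (simp add: dual_gauge_nonneg[OF assms])
  show ?thesis
  proof (rule even_gaugeI[where c="1/C" and C="1/c"])
    show "dual_gauge p (a *\<^sub>R y) = \<bar>a\<bar> * dual_gauge p y" for a y
    proof (cases "a = 0")
      case True
      then show ?thesis using le[of 0 y] dual_gauge_nonneg[OF assms, of 0] by simp
    next
      case False
      then have "\<bar>a\<bar> * dual_gauge p y \<le> dual_gauge p (a *\<^sub>R y)"
        using le[of "inverse a" "a *\<^sub>R y"] by (simp add: field_simps)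
      with le[of a y] show ?thesis by simp
    qed
    show "1 / C * norm y \<le> dual_gauge p y" for y
      using dual_gauge_antimono[OF assms even_gauge_norm, of C y] c
      by (simp add: dual_gauge_norm field_simps)
    have "norm x \<le> 1 / c * p x" for x using c(1) c(3)[of x] by (simp add: field_simps)
    then show "dual_gauge p y \<le> 1 / c * norm y" for y
      using dual_gauge_antimono[OF even_gauge_norm assms, of "1/c" y] c
      by (simp add: dual_gauge_norm)
  qed (use c in auto)
qed

subsection \<open>The limit of the averaging iteration\<close>

definition mean_gauge ::
  "((real^'n) \<times> (real^'n) \<Rightarrow> real) \<Rightarrow> (real^'n) \<times> (real^'n) \<Rightarrow> real" where
  "mean_gauge p x = (p x + dual_gauge p x) / 2"

definition limit_gauge ::
  "((real^'n) \<times> (real^'n) \<Rightarrow> real) \<Rightarrow> (real^'n) \<times> (real^'n) \<Rightarrow> real" where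
  "limit_gauge p x = lim (\<lambda>n. (mean_gauge ^^ n) p x)"

lemma even_gauge_mean_gauge:
  assumes "even_gauge p"
  shows "even_gauge (mean_gauge p)"
proof -
  have "even_gauge (\<lambda>x. 1/2 * (p x + dual_gauge p x))"
    by (intro even_gauge_cmult even_gauge_add even_gauge_dual_gauge assms) simp
  moreover have "mean_gauge p = (\<lambda>x. 1/2 * (p x + dual_gauge p x))"
    by (auto simp: mean_gauge_def)
  ultimately show ?thesis by simp
qed

text \<open>With \<open>a = p x\<close>, \<open>b = p\<^sup>* x\<close>, \<open>c = p y\<close>, \<open>d = p\<^sup>* y\<close>, the two bounds available for \<open>w = \<omega>(x, y)\<close>
  are \<open>a d\<close> and \<open>b c\<close>.\<close>

lemma mean_mult_mean_ge:
  fixes a b c d w :: real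
  assumes "0 \<le> a" "0 \<le> b" "0 \<le> c" "0 \<le> d" "w \<le> a * d" "w \<le> b * c"
  shows "w \<le> ((a + b) / 2) * ((c + d) / 2)"
proof (cases "w \<le> 0")
  case True
  have "0 \<le> ((a + b) / 2) * ((c + d) / 2)" using assms by auto
  with True show ?thesis by simp
next
  case False
  \<comment> \<open>Multiplying the two bounds gives
    \<open>w\<^sup>2 \<le> (a * c) * (b * d)\<close>, hence \<open>2 * w \<le> a * c + b * d\<close>
    by the arithmetic-geometric mean inequality. The cross terms \<open>a * d\<close> and
    \<open>b * c\<close> of the expanded product supply the remaining \<open>2 * w\<close>.\<close>
  have "4 * w\<^sup>2 \<le> 4 * ((a * d) * (b * c))"
    unfolding power2_eq_square using assms False by (intro mult_left_mono mult_mono) auto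
  also have "\<dots> = (a * c + b * d)\<^sup>2 - (a * c - b * d)\<^sup>2"
    by (simp add: power2_eq_square algebra_simps)
  also have "\<dots> \<le> (a * c + b * d)\<^sup>2" by simp
  finally have "(2 * w)\<^sup>2 \<le> (a * c + b * d)\<^sup>2" by (simp add: power_mult_distrib)
  moreover have "0 \<le> a * c + b * d" using assms(1-4) by simp
  ultimately have "2 * w \<le> a * c + b * d" by (rule power2_le_imp_le)
  with assms(5,6) have "4 * w \<le> a * c + b * d + a * d + b * c" by linarith
  also have "\<dots> = 4 * (((a + b) / 2) * ((c + d) / 2))" by (simp add: algebra_simps)
  finally show ?thesis by simp
qed

text \<open>Skew-symmetry and evenness give a second bound on the form, with the roles of
  \<open>p\<close> and its dual exchanged; \<open>mean_mult_mean_ge\<close> merges both into a bound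
  by the product of the means.\<close>

lemma dual_gauge_mean_gauge_le:
  assumes "even_gauge p"
  shows "dual_gauge (mean_gauge p) y \<le> mean_gauge p y"
proof (rule dual_gauge_le)
  show "even_gauge (mean_gauge p)" by (rule even_gauge_mean_gauge[OF assms])
  then show "0 \<le> mean_gauge p y" by (rule even_gauge_nonneg)
  fix x
  have "symplectic_form x y = symplectic_form (- y) x"
    using symplectic_form_skew[of x y] symplectic_form_scale_left[of "-1" y x] by simp
  also have "\<dots> \<le> p y * dual_gauge p x"
    using symplectic_form_le_dual_gauge[OF assms, of "- y" x] by (simp add: even_gauge_minus[OF assms])
  finally have "symplectic_form x y \<le> dual_gauge p x * p y" by (simp add: mult.commute)
  then show "symplectic_form x y \<le> mean_gauge p x * mean_gauge p y"
    unfolding mean_gauge_def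
    by (intro mean_mult_mean_ge symplectic_form_le_dual_gauge[OF assms]
        even_gauge_nonneg[OF assms] dual_gauge_nonneg[OF assms])
qed

section \<open>Convergence of the iteration from a fixed even gauge\<close>

context
  fixes p :: "(real^'n) \<times> (real^'n) \<Rightarrow> real"
  assumes p: "even_gauge p"
begin

lemma even_gauge_iterate: "even_gauge ((mean_gauge ^^ n) p)"
  by (induction n) (auto simp: p even_gauge_mean_gauge)

text \<open>From index 1 on every iterate is a mean and so dominates its dual, while
  \<open>p\<close> itself may not. Hence the shift by \<open>Suc\<close> in the statements that
  follow.\<close>

lemma dual_gauge_iterate_le: "dual_gauge ((mean_gauge ^^ Suc n) p) x \<le> (mean_gauge ^^ Suc n) p x"
  using dual_gauge_mean_gauge_le[OF even_gauge_iterate] by simp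

lemma decseq_iterate: "decseq (\<lambda>n. (mean_gauge ^^ Suc n) p x)"
proof (rule decseq_SucI)
  show "(mean_gauge ^^ Suc (Suc n)) p x \<le> (mean_gauge ^^ Suc n) p x" for n
    using dual_gauge_iterate_le[of n x] by (simp add: mean_gauge_def[of "mean_gauge _"])
qed

lemma iterate_tendsto: "(\<lambda>n. (mean_gauge ^^ Suc n) p x) \<longlonglongrightarrow> limit_gauge p x"
proof -
  obtain L where L: "(\<lambda>n. (mean_gauge ^^ Suc n) p x) \<longlonglongrightarrow> L"
    by (rule decseq_convergent[OF decseq_iterate])
      (blast intro: even_gauge_nonneg[OF even_gauge_iterate])
  have "limit_gauge p x = L"
    unfolding limit_gauge_def by (rule limI[OF LIMSEQ_imp_Suc[OF L]])
  with L show ?thesis by simp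
qed

lemma limit_gauge_le: "limit_gauge p x \<le> (mean_gauge ^^ Suc n) p x"
  by (rule decseq_ge[OF decseq_iterate iterate_tendsto])

text \<open>The dual is twice the next iterate minus the current one, and both of these have the
  same limit.\<close>

lemma dual_iterate_tendsto: "(\<lambda>n. dual_gauge ((mean_gauge ^^ Suc n) p) x) \<longlonglongrightarrow> limit_gauge p x"
proof -
  have dual: "dual_gauge q x = 2 * mean_gauge q x - q x" for q :: "(real^'n) \<times> (real^'n) \<Rightarrow> real"
    by (simp add: mean_gauge_def field_simps)
  have "(\<lambda>n. dual_gauge ((mean_gauge ^^ Suc n) p) x)
      = (\<lambda>n. 2 * (mean_gauge ^^ Suc (Suc n)) p x - (mean_gauge ^^ Suc n) p x)"
    unfolding dual by simp
  moreover have "(\<lambda>n. 2 * (mean_gauge ^^ Suc (Suc n)) p x - (mean_gauge ^^ Suc n) p x)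
      \<longlonglongrightarrow> 2 * limit_gauge p x - limit_gauge p x"
    by (intro tendsto_diff tendsto_mult_left iterate_tendsto LIMSEQ_Suc[OF iterate_tendsto])
  ultimately show ?thesis by (simp only: mult_2 add_diff_cancel)
qed

text \<open>The iterates decrease, so their duals increase to the common limit and bound it from
  below; this keeps the limit away from zero.\<close>

lemma dual_iterate_le_limit_gauge: "dual_gauge ((mean_gauge ^^ Suc n) p) x \<le> limit_gauge p x"
proof (rule incseq_le[OF _ dual_iterate_tendsto])
  show "incseq (\<lambda>n. dual_gauge ((mean_gauge ^^ Suc n) p) x)"
  proof (rule incseq_SucI)
    show "dual_gauge ((mean_gauge ^^ Suc n) p) x \<le> dual_gauge ((mean_gauge ^^ Suc (Suc n)) p) x" for n
      using dual_gauge_antimono[OF even_gauge_iterate even_gauge_iterate, of "Suc (Suc n)" 1 "Suc n" x]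
        decseq_SucD[OF decseq_iterate, of n] by simp
  qed
qed

lemma even_gauge_limit_gauge: "even_gauge (limit_gauge p)"
proof -
  \<comment> \<open>The first mean bounds the limit from above and its dual bounds it from below,
    which yields the two constants.\<close>
  let ?q = "(mean_gauge ^^ Suc 0) p"
  obtain C where C: "C > 0" "\<And>x. ?q x \<le> C * norm x"
    using even_gauge_upper[OF even_gauge_iterate[of "Suc 0"]] by blast
  obtain c where c: "c > 0" "\<And>x. c * norm x \<le> dual_gauge ?q x"
    using even_gauge_lower[OF even_gauge_dual_gauge[OF even_gauge_iterate[of "Suc 0"]]] by blast
  show ?thesis
  proof (rule even_gaugeI)
    show "limit_gauge p (a *\<^sub>R x) = \<bar>a\<bar> * limit_gauge p x" for a x
    proof (rule LIMSEQ_unique[OF iterate_tendsto])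
      show "(\<lambda>n. (mean_gauge ^^ Suc n) p (a *\<^sub>R x)) \<longlonglongrightarrow> \<bar>a\<bar> * limit_gauge p x"
        unfolding even_gauge_scale[OF even_gauge_iterate]
        by (intro tendsto_intros iterate_tendsto)
    qed
    show "c * norm x \<le> limit_gauge p x" for x
      using c(2)[of x] dual_iterate_le_limit_gauge[of 0 x] by linarith
    show "limit_gauge p x \<le> C * norm x" for x
      using C(2)[of x] limit_gauge_le[of x 0] by linarith
  qed fact+
qed

text \<open>One inequality is the limit of
  \<open>symplectic_form x y \<le> q x * dual_gauge q y\<close> along the iterates \<open>q\<close>.
  For the other, the limit lies below every iterate, so its dual lies above every dual iterate, and
  these tend to the limit.\<close>

lemma self_dual_limit_gauge: "self_dual_gauge (limit_gauge p)"
proof -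
  have "dual_gauge (limit_gauge p) y \<le> limit_gauge p y" for y
  proof (rule dual_gauge_le[OF even_gauge_limit_gauge])
    show "0 \<le> limit_gauge p y" by (rule even_gauge_nonneg[OF even_gauge_limit_gauge])
    show "symplectic_form x y \<le> limit_gauge p x * limit_gauge p y" for x
      by (rule LIMSEQ_le_const[OF tendsto_mult[OF iterate_tendsto dual_iterate_tendsto]])
        (intro exI allI impI symplectic_form_le_dual_gauge even_gauge_iterate)
  qed
  moreover have "limit_gauge p y \<le> dual_gauge (limit_gauge p) y" for y
  proof (rule LIMSEQ_le_const2[OF dual_iterate_tendsto], intro exI allI impI)
    show "dual_gauge ((mean_gauge ^^ Suc n) p) y \<le> dual_gauge (limit_gauge p) y" for n
      using dual_gauge_antimono[OF even_gauge_limit_gauge even_gauge_iterate, of 1 "Suc n" y]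
        limit_gauge_le by simp
  qed
  ultimately show ?thesis
    unfolding self_dual_gauge_def using even_gauge_limit_gauge by (simp add: fun_eq_iff antisym)
qed

end

lemma limit_gauge_self_dual:
  assumes "self_dual_gauge p"
  shows "limit_gauge p = p"
proof -
  have "mean_gauge p = p" using assms by (auto simp: self_dual_gauge_def mean_gauge_def)
  then have "(mean_gauge ^^ n) p = p" for n by (induction n) auto
  then show ?thesis by (auto simp: limit_gauge_def)
qed

text \<open>Duality exchanges the two inequalities, so both must be carried through the induction
  together.\<close>

lemma iterate_mono:
  assumes "even_gauge p" "even_gauge q" "0 \<le> l" "\<And>x. p x \<le> l * q x" "\<And>x. q x \<le> l * p x"
  shows "(mean_gauge ^^ n) p x \<le> l * (mean_gauge ^^ n) q x \<and>
    (mean_gauge ^^ n) q x \<le> l * (mean_gauge ^^ n) p x"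
proof (induction n arbitrary: x)
  case (Suc n)
  let ?p = "(mean_gauge ^^ n) p" and ?q = "(mean_gauge ^^ n) q"
  have "even_gauge ?p" "even_gauge ?q" by (auto intro: even_gauge_iterate assms)
  then have "dual_gauge ?q x \<le> l * dual_gauge ?p x" "dual_gauge ?p x \<le> l * dual_gauge ?q x"
    using Suc assms(3) by (blast intro: dual_gauge_antimono)+
  with Suc[of x] have "?p x + dual_gauge ?p x \<le> l * (?q x + dual_gauge ?q x)"
    "?q x + dual_gauge ?q x \<le> l * (?p x + dual_gauge ?p x)"
    by (auto simp only: distrib_left intro: add_mono)
  then show ?case by (simp add: mean_gauge_def[of ?p x] mean_gauge_def[of ?q x])
qed (simp add: assms)

text \<open>The passage to the limit does not enlarge the multiplicative distance between gauges;
  this is the source of continuity.\<close>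

lemma limit_gauge_mono:
  assumes "even_gauge p" "even_gauge q" "0 \<le> l" "\<And>x. p x \<le> l * q x" "\<And>x. q x \<le> l * p x"
  shows "limit_gauge p x \<le> l * limit_gauge q x"
proof (rule LIMSEQ_le[OF iterate_tendsto[OF assms(1)]])
  show "(\<lambda>n. l * (mean_gauge ^^ Suc n) q x) \<longlonglongrightarrow> l * limit_gauge q x"
    by (intro tendsto_intros iterate_tendsto assms)
  show "\<exists>N. \<forall>n\<ge>N. (mean_gauge ^^ Suc n) p x \<le> l * (mean_gauge ^^ Suc n) q x"
    using iterate_mono[OF assms] by blast
qed

subsection \<open>Self-polar bodies and self-dual gauges\<close>

definition gauge_body :: "('a \<Rightarrow> real) \<Rightarrow> 'a set" where
  "gauge_body p = {x. p x \<le> 1}"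

text \<open>The Euclidean support function of the rotated body. For a self-polar body it is also the
  Minkowski functional, and in this form the Hausdorff distance controls it directly.\<close>

definition symplectic_support ::
  "((real^'n) \<times> (real^'n)) set \<Rightarrow> (real^'n) \<times> (real^'n) \<Rightarrow> real" where
  "symplectic_support X y = (SUP x\<in>X. symplectic_form x y)"

lemma gauge_body_scale:
  assumes "even_gauge p" "p x \<le> l" "0 < l"
  shows "(1 / l) *\<^sub>R x \<in> gauge_body p"
  using assms by (simp add: gauge_body_def even_gauge_scale field_simps)

lemma bounded_gauge_body:
  assumes "even_gauge p"
  shows "\<exists>R>0. \<forall>x\<in>gauge_body p. norm x \<le> R"
proof -
  obtain c where c: "c > 0" "\<And>x. c * norm x \<le> p x" using even_gauge_lower[OF assms] by blast
  have "norm x \<le> 1 / c" if "x \<in> gauge_body p" for x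
    using c(1) c(2)[of x] that by (simp add: gauge_body_def field_simps)
  with c(1) show ?thesis by (intro exI[of _ "1/c"]) auto
qed

lemma zero_in_gauge_body: "even_gauge p \<Longrightarrow> 0 \<in> gauge_body p"
  by (simp add: gauge_body_def even_gauge_zero)

lemma zero_in_interior_gauge_body:
  fixes p :: "'a::real_normed_vector \<Rightarrow> real"
  assumes "even_gauge p"
  shows "0 \<in> interior (gauge_body p)"
proof -
  obtain C where C: "C > 0" "\<And>x. p x \<le> C * norm x" using even_gauge_upper[OF assms] by blast
  have "ball 0 (1 / C) \<subseteq> gauge_body p"
  proof
    fix x :: 'a
    assume "x \<in> ball 0 (1 / C)"
    then have "C * norm x \<le> 1" using C(1) by (simp add: field_simps)
    with C(2)[of x] show "x \<in> gauge_body p" by (simp add: gauge_body_def)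
  qed
  then show ?thesis using C(1) by (meson centre_in_ball interiorI open_ball zero_less_divide_1_iff)
qed

lemma symplectic_polar_eq_halfspaces:
  "symplectic_polar X = (\<Inter>x\<in>X. {y. symplectic_rotation x \<bullet> y \<le> 1})"
  by (auto simp: symplectic_polar_def symplectic_form_eq_inner)

lemma closed_symplectic_polar: "closed (symplectic_polar X)"
  unfolding symplectic_polar_eq_halfspaces by (intro closed_INT ballI closed_halfspace_le)

lemma convex_symplectic_polar: "convex (symplectic_polar X)"
  unfolding symplectic_polar_eq_halfspaces by (intro convex_INT convex_halfspace_le)

text \<open>The polar only tests points with \<open>p x \<le> 1\<close>; rescaling a nonzero
  \<open>x\<close> to gauge 1 recovers the homogeneous inequality that defines the dual.\<close>

lemma symplectic_polar_gauge_body: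
  assumes "even_gauge p"
  shows "symplectic_polar (gauge_body p) = gauge_body (dual_gauge p)"
proof (intro set_eqI iffI)
  fix y assume y: "y \<in> symplectic_polar (gauge_body p)"
  have "dual_gauge p y \<le> 1"
  proof (rule dual_gauge_le[OF assms])
    show "symplectic_form x y \<le> p x * 1" for x
    proof (cases "x = 0")
      case False
      then have pos: "p x > 0" by (rule even_gauge_pos[OF assms])
      then have "symplectic_form ((1 / p x) *\<^sub>R x) y \<le> 1"
        using y gauge_body_scale[OF assms order_refl] by (simp add: symplectic_polar_def)
      then show ?thesis using pos by (simp add: symplectic_form_scale_left field_simps)
    qed (simp add: even_gauge_zero[OF assms])
  qed simp
  then show "y \<in> gauge_body (dual_gauge p)" by (simp add: gauge_body_def)
next
  fix y assume y: "y \<in> gauge_body (dual_gauge p)"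
  have "symplectic_form x y \<le> 1" if "x \<in> gauge_body p" for x
  proof -
    have "symplectic_form x y \<le> p x * dual_gauge p y"
      by (rule symplectic_form_le_dual_gauge[OF assms])
    also have "\<dots> \<le> 1 * 1"
      using y that dual_gauge_nonneg[OF assms]
      by (intro mult_mono) (auto simp: gauge_body_def)
    finally show ?thesis by simp
  qed
  then show "y \<in> symplectic_polar (gauge_body p)" by (simp add: symplectic_polar_def)
qed

text \<open>Closedness and convexity come from the body being a polar, that is, an intersection of
  halfspaces; the gauge bounds give boundedness and the interior point.\<close>

lemma gauge_body_self_polar:
  assumes "self_dual_gauge p"
  shows "gauge_body p \<in> self_polar_bodies"
proof -
  have p: "even_gauge p" and "dual_gauge p = p" using assms by (auto simp: self_dual_gauge_def)
  then have polar: "gauge_body p = symplectic_polar (gauge_body p)"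
    by (simp add: symplectic_polar_gauge_body)
  have "bounded (gauge_body p)" using bounded_gauge_body[OF p] by (auto simp: bounded_iff)
  moreover have "closed (gauge_body p)" "convex (gauge_body p)"
    using polar closed_symplectic_polar[of "gauge_body p"] convex_symplectic_polar[of "gauge_body p"]
    by auto
  ultimately show ?thesis
    using polar zero_in_interior_gauge_body[OF p]
    by (auto simp: self_polar_bodies_def symplectically_self_polar_def convex_body_def
        compact_eq_bounded_closed)
qed

section \<open>The support function of a self-polar body\<close>

context
  fixes X :: "((real^'n) \<times> (real^'n)) set"
  assumes X: "X \<in> self_polar_bodies"
begin

lemma self_polar_compact: "compact X"
  using X by (auto simp: self_polar_bodies_def symplectically_self_polar_def convex_body_def)

lemma self_polar_zero_interior: "0 \<in> interior X"
  using X by (auto simp: self_polar_bodies_def symplectically_self_polar_def)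

lemma self_polar_nonempty: "X \<noteq> {}"
  using self_polar_zero_interior by auto

lemma self_polar_mem_iff: "y \<in> X \<longleftrightarrow> (\<forall>x\<in>X. symplectic_form x y \<le> 1)"
  using X by (auto simp: self_polar_bodies_def symplectically_self_polar_def symplectic_polar_def)

text \<open>Swapping the arguments of the form changes its sign, and membership in a self-polar body
  is a condition on pairs of its points. So such bodies are centrally symmetric and are described by
  even gauges.\<close>

lemma self_polar_minus:
  assumes "y \<in> X"
  shows "- y \<in> X"
proof -
  have "symplectic_form x (- y) = symplectic_form y x" for x
    using symplectic_form_scale_right[of x "-1" y] symplectic_form_skew[of x y] by simp
  then show ?thesis using self_polar_mem_iff assms by metis
qed

lemma symplectic_support_upper: "x \<in> X \<Longrightarrow> symplectic_form x y \<le> symplectic_support X y"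
  unfolding symplectic_support_def
proof (intro cSUP_upper)
  obtain R where R: "\<And>x. x \<in> X \<Longrightarrow> norm x \<le> R"
    using compact_imp_bounded[OF self_polar_compact] by (auto simp: bounded_iff)
  have "symplectic_form x y \<le> R * norm y" if "x \<in> X" for x
    using symplectic_form_le_norm[of x y] mult_right_mono[OF R[OF that], of "norm y"] by simp
  then show "bdd_above ((\<lambda>x. symplectic_form x y) ` X)" by (rule bdd_aboveI2)
qed

lemma symplectic_support_le:
  "(\<And>x. x \<in> X \<Longrightarrow> symplectic_form x y \<le> r) \<Longrightarrow> symplectic_support X y \<le> r"
  unfolding symplectic_support_def using self_polar_nonempty by (intro cSUP_least) auto

lemma gauge_body_symplectic_support: "gauge_body (symplectic_support X) = X"
proof (intro set_eqI iffI)
  show "y \<in> gauge_body (symplectic_support X)" if "y \<in> X" for y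
    using that self_polar_mem_iff[of y] by (simp add: gauge_body_def symplectic_support_le)
  show "y \<in> X" if "y \<in> gauge_body (symplectic_support X)" for y
    unfolding self_polar_mem_iff[of y]
  proof
    show "symplectic_form x y \<le> 1" if "x \<in> X" for x
      using symplectic_support_upper[OF that, of y] \<open>y \<in> gauge_body _\<close> by (simp add: gauge_body_def)
  qed
qed

lemma even_gauge_symplectic_support: "even_gauge (symplectic_support X)"
proof -
  obtain R where R: "R > 0" "\<And>x. x \<in> X \<Longrightarrow> norm x \<le> R"
    using compact_imp_bounded[OF self_polar_compact] by (auto simp: bounded_pos)
  obtain r where r: "r > 0" "cball 0 r \<subseteq> X"
    using self_polar_zero_interior by (auto simp: mem_interior_cball)
  have zero: "0 \<le> symplectic_support X 0"
    using symplectic_support_upper[OF subsetD[OF interior_subset self_polar_zero_interior], of 0]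
    by simp
  have le: "symplectic_support X (a *\<^sub>R y) \<le> \<bar>a\<bar> * symplectic_support X y" for a y
  proof (rule symplectic_support_le)
    fix x assume x: "x \<in> X"
    \<comment> \<open>Central symmetry absorbs the sign of \<open>a\<close> into the point of
      \<open>X\<close>.\<close>
    define z where "z = (if a \<ge> 0 then x else - x)"
    have "z \<in> X" using x self_polar_minus by (simp add: z_def)
    have "symplectic_form x (a *\<^sub>R y) = \<bar>a\<bar> * symplectic_form z y"
      using symplectic_form_scale_left[of "-1" x y]
      by (simp add: z_def symplectic_form_scale_right)
    also have "\<dots> \<le> \<bar>a\<bar> * symplectic_support X y"
      using symplectic_support_upper[OF \<open>z \<in> X\<close>] by (intro mult_left_mono) auto
    finally show "symplectic_form x (a *\<^sub>R y) \<le> \<bar>a\<bar> * symplectic_support X y" .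
  qed
  show ?thesis
  proof (rule even_gaugeI)
    show "symplectic_support X (a *\<^sub>R y) = \<bar>a\<bar> * symplectic_support X y" for a y
    proof (cases "a = 0")
      case True
      with zero show ?thesis using le[of 0 y] by simp
    next
      case False
      then have "\<bar>a\<bar> * symplectic_support X y \<le> symplectic_support X (a *\<^sub>R y)"
        using le[of "inverse a" "a *\<^sub>R y"] by (simp add: field_simps)
      with le[of a y] show ?thesis by simp
    qed
    show "r * norm y \<le> symplectic_support X y" for y
    proof (cases "y = 0")
      case True
      with zero show ?thesis by simp
    next
      case False
      obtain x where x: "norm x = norm y" "symplectic_form x y = norm y * norm y"
        by (rule symplectic_form_attains_norm)
      \<comment> \<open>The extremal vector for \<open>y\<close>, rescaled to length
        \<open>r\<close>, lies in the inscribed ball and pairs with \<open>y\<close> to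
        \<open>r * norm y\<close>.\<close>
      have "(r / norm y) *\<^sub>R x \<in> X" using r x False by (intro subsetD[OF r(2)]) simp
      from symplectic_support_upper[OF this, of y] show ?thesis
        using x False by (simp add: symplectic_form_scale_left)
    qed
    show "symplectic_support X y \<le> R * norm y" for y
    proof (rule symplectic_support_le)
      show "symplectic_form x y \<le> R * norm y" if "x \<in> X" for x
        using symplectic_form_le_norm[of x y] mult_right_mono[OF R(2)[OF that], of "norm y"] by simp
    qed
  qed fact+
qed

text \<open>Rescaling \<open>x\<close> into \<open>X\<close> bounds the form by the product of two
  support values, so the dual is at most the support. Conversely, points of \<open>X\<close> have
  support value at most 1, so their pairing with \<open>y\<close> is at most the dual at
  \<open>y\<close>.\<close>

lemma self_dual_symplectic_support: "self_dual_gauge (symplectic_support X)"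
proof -
  note p = even_gauge_symplectic_support
  have "dual_gauge (symplectic_support X) y = symplectic_support X y" for y
  proof (rule antisym)
    show "dual_gauge (symplectic_support X) y \<le> symplectic_support X y"
    proof (rule dual_gauge_le[OF p even_gauge_nonneg[OF p]])
      show "symplectic_form x y \<le> symplectic_support X x * symplectic_support X y" for x
      proof (cases "x = 0")
        case False
        then have pos: "symplectic_support X x > 0" by (rule even_gauge_pos[OF p])
        then have "(1 / symplectic_support X x) *\<^sub>R x \<in> X"
          using gauge_body_scale[OF p order_refl] gauge_body_symplectic_support by simp
        from symplectic_support_upper[OF this, of y] show ?thesis
          using pos by (simp add: symplectic_form_scale_left field_simps)
      qed (simp add: even_gauge_zero[OF p])
    qed
    show "symplectic_support X y \<le> dual_gauge (symplectic_support X) y"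
    proof (rule symplectic_support_le)
      fix x assume "x \<in> X"
      then have "symplectic_support X x \<le> 1"
        using gauge_body_symplectic_support by (auto simp: gauge_body_def)
      then have "symplectic_support X x * dual_gauge (symplectic_support X) y
          \<le> 1 * dual_gauge (symplectic_support X) y"
        by (rule mult_right_mono[OF _ dual_gauge_nonneg[OF p]])
      with symplectic_form_le_dual_gauge[OF p, of x y]
      show "symplectic_form x y \<le> dual_gauge (symplectic_support X) y" by simp
    qed
  qed
  with p show ?thesis by (simp add: self_dual_gauge_def fun_eq_iff)
qed

end

subsection \<open>Comparison with the Hausdorff distance\<close>

text \<open>Each point of \<open>X\<close> is replaced by a nearest point of \<open>Y\<close>; the
  change in the form is at most the displacement times \<open>norm y\<close>.\<close>

lemma symplectic_support_le_hausdorff: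
  assumes "X \<in> self_polar_bodies" "Y \<in> self_polar_bodies"
  shows "symplectic_support X y \<le> symplectic_support Y y + hausdorff_distance X Y * norm y"
proof (rule symplectic_support_le[OF assms(1)])
  fix x assume x: "x \<in> X"
  note cX = self_polar_compact[OF assms(1)] and cY = self_polar_compact[OF assms(2)]
  obtain z where z: "z \<in> Y" "infdist x Y = dist x z"
    using infdist_attains_inf[OF compact_imp_closed[OF cY] self_polar_nonempty[OF assms(2)]] by metis
  have "dist x z \<le> hausdorff_distance X Y"
    using infdist_le_hausdorff_distance[of X Y x] cX cY x z self_polar_nonempty[OF assms(2)]
    by (simp add: compact_imp_bounded)
  then have "norm (x - z) * norm y \<le> hausdorff_distance X Y * norm y"
    by (intro mult_right_mono) (auto simp: dist_norm)
  moreover have "symplectic_form (x - z) y \<le> norm (x - z) * norm y"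
    by (rule symplectic_form_le_norm)
  moreover have "symplectic_form z y \<le> symplectic_support Y y"
    by (rule symplectic_support_upper[OF assms(2) z(1)])
  ultimately show "symplectic_form x y \<le> symplectic_support Y y + hausdorff_distance X Y * norm y"
    by (simp add: symplectic_form_diff_left)
qed

lemma abs_symplectic_support_diff_le:
  assumes "X \<in> self_polar_bodies" "Y \<in> self_polar_bodies"
  shows "\<bar>symplectic_support X y - symplectic_support Y y\<bar> \<le> hausdorff_distance X Y * norm y"
  using symplectic_support_le_hausdorff[OF assms, of y]
    symplectic_support_le_hausdorff[OF assms(2,1), of y]
  by (simp add: hausdorff_distance_commute)

text \<open>Shrinking by \<open>1 / l\<close> moves each body into the other and displaces
  \<open>x\<close> by \<open>(1 - 1 / l) * norm x\<close>. The radius \<open>R\<close> refers to one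
  body only, so it can be fixed before the other is chosen.\<close>

lemma hausdorff_distance_gauge_body_le:
  fixes p q :: "'a::real_normed_vector \<Rightarrow> real"
  assumes p: "even_gauge p" and q: "even_gauge q" and l: "1 \<le> l"
    and pq: "\<And>x. p x \<le> l * q x" "\<And>x. q x \<le> l * p x"
    and R: "\<And>x. x \<in> gauge_body p \<Longrightarrow> norm x \<le> R"
  shows "hausdorff_distance (gauge_body p) (gauge_body q) \<le> (l - 1) * R"
proof (rule hausdorff_distance_le)
  have near: "infdist x (gauge_body g) \<le> (1 - 1 / l) * norm x"
    if "even_gauge g" "g x \<le> l" for x and g :: "'a \<Rightarrow> real"
  proof -
    have "infdist x (gauge_body g) \<le> dist x ((1 / l) *\<^sub>R x)"
      by (intro infdist_le gauge_body_scale) (use that l in auto)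
    also have "\<dots> = norm ((1 - 1 / l) *\<^sub>R x)" by (simp add: dist_norm algebra_simps)
    also have "\<dots> = (1 - 1 / l) * norm x" using l by simp
    finally show ?thesis .
  qed
  have "norm (0::'a) \<le> R" using R zero_in_gauge_body[OF p] by blast
  then have "0 \<le> R" by simp
  then show "0 \<le> (l - 1) * R" using l by simp
  show "infdist x (gauge_body q) \<le> (l - 1) * R" if "x \<in> gauge_body p" for x
  proof -
    have "l * p x \<le> l * 1" using that l by (intro mult_left_mono) (auto simp: gauge_body_def)
    then have "infdist x (gauge_body q) \<le> (1 - 1 / l) * norm x"
      using pq(2)[of x] by (intro near q) simp
    also have "\<dots> \<le> (l - 1) * R"
    proof (rule mult_mono)
      show "1 - 1 / l \<le> l - 1"
        using l zero_le_power2[of "l - 1"] by (simp add: field_simps power2_eq_square)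
    qed (use R that l in auto)
    finally show ?thesis .
  qed
  show "infdist x (gauge_body p) \<le> (l - 1) * R" if "x \<in> gauge_body q" for x
  proof -
    have "l * q x \<le> l * 1" using that l by (intro mult_left_mono) (auto simp: gauge_body_def)
    then have xl: "p x \<le> l" using pq(1)[of x] by simp
    \<comment> \<open>The bound \<open>R\<close> holds on the body of \<open>p\<close>, so it is
      applied to the shrunken point; this gives \<open>norm x \<le> l * R\<close> and accounts for
      the factor \<open>l - 1\<close> in place of \<open>1 - 1 / l\<close>.\<close>
    then have "norm ((1 / l) *\<^sub>R x) \<le> R" using l by (intro R gauge_body_scale p) auto
    then have "(l - 1) * (norm x / l) \<le> (l - 1) * R" using l by (intro mult_left_mono) auto
    moreover have "(1 - 1 / l) * norm x = (l - 1) * (norm x / l)" using l by (simp add: field_simps)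
    ultimately show ?thesis using near[OF p xl] by simp
  qed
qed (use zero_in_gauge_body p q in auto)

text \<open>The lower bound \<open>c * norm x \<le> p x\<close> converts the additive error
  \<open>e * norm x\<close> into a relative one; the condition on \<open>e\<close> says
  \<open>e \<le> c * (1 - 1 / l)\<close>.\<close>

lemma gauge_close_imp_ratio:
  fixes p q :: "'a::real_normed_vector \<Rightarrow> real"
  assumes "c > 0" "\<And>x. c * norm x \<le> p x" "1 \<le> l" "l * e \<le> c * (l - 1)"
    "\<And>x. \<bar>q x - p x\<bar> \<le> e * norm x" "0 \<le> e"
  shows "p x \<le> l * q x" "q x \<le> l * p x"
proof -
  have "l * e * norm x \<le> (l - 1) * (c * norm x)"
    using mult_right_mono[OF assms(4), of "norm x"] by (simp add: algebra_simps)
  also have "\<dots> \<le> (l - 1) * p x" using assms by (intro mult_left_mono) auto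
  finally have 1: "l * e * norm x \<le> (l - 1) * p x" .
  have "l * (p x - q x) \<le> l * (e * norm x)"
    using assms(3) assms(5)[of x] by (intro mult_left_mono) auto
  with 1 show "p x \<le> l * q x" by (simp add: algebra_simps)
  have "1 * (e * norm x) \<le> l * (e * norm x)" using assms by (intro mult_right_mono) auto
  with 1 assms(5)[of x] show "q x \<le> l * p x" by (simp add: algebra_simps)
qed

subsection \<open>The contraction\<close>

definition homotopy_gauge ::
  "real \<Rightarrow> ((real^'n) \<times> (real^'n)) set \<Rightarrow> (real^'n) \<times> (real^'n) \<Rightarrow> real" where
  "homotopy_gauge t X x = (1 - t) * symplectic_support X x + t * norm x"

definition self_polar_homotopy ::
  "real \<times> ((real^'n) \<times> (real^'n)) set \<Rightarrow> ((real^'n) \<times> (real^'n)) set" where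
  "self_polar_homotopy = (\<lambda>(t, X). gauge_body (limit_gauge (homotopy_gauge t X)))"

lemma even_gauge_homotopy_gauge:
  assumes X: "X \<in> self_polar_bodies" and t: "0 \<le> t" "t \<le> 1"
  shows "even_gauge (homotopy_gauge t X)"
proof -
  note p = even_gauge_symplectic_support[OF X]
  \<comment> \<open>The endpoints are separate because \<open>even_gauge_cmult\<close> takes a
    positive factor.\<close>
  consider "t = 0" | "t = 1" | "0 < t" "t < 1" using t by linarith
  then show ?thesis
  proof cases
    case 1
    then have "homotopy_gauge t X = symplectic_support X" by (auto simp: homotopy_gauge_def)
    with p show ?thesis by simp
  next
    case 2
    then have "homotopy_gauge t X = norm" by (auto simp: homotopy_gauge_def)
    with even_gauge_norm show ?thesis by simp
  next
    case 3
    then have "even_gauge (\<lambda>x. (1 - t) * symplectic_support X x + t * norm x)"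
      by (intro even_gauge_add even_gauge_cmult p even_gauge_norm) auto
    then show ?thesis by (simp add: homotopy_gauge_def[abs_def])
  qed
qed

lemma self_polar_homotopy_in:
  assumes "X \<in> self_polar_bodies" "0 \<le> t" "t \<le> 1"
  shows "self_polar_homotopy (t, X) \<in> self_polar_bodies"
  using assms
  by (simp add: self_polar_homotopy_def gauge_body_self_polar self_dual_limit_gauge
      even_gauge_homotopy_gauge)

text \<open>The difference splits into a change of body at fixed \<open>t\<close> and a change of
  time at fixed \<open>Y\<close>, so only the support of \<open>Y\<close> needs the constant
  \<open>C\<close>.\<close>

lemma homotopy_gauge_diff_le:
  assumes X: "X \<in> self_polar_bodies" and Y: "Y \<in> self_polar_bodies" and t: "0 \<le> t" "t \<le> 1"
    and C: "\<And>x. symplectic_support Y x \<le> C * norm x"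
  shows "\<bar>homotopy_gauge t X x - homotopy_gauge s Y x\<bar>
    \<le> (hausdorff_distance X Y + \<bar>t - s\<bar> * (C + 1)) * norm x"
proof -
  let ?p = "symplectic_support X x" and ?q = "symplectic_support Y x"
  have "\<bar>(1 - t) * (?p - ?q)\<bar> \<le> 1 * (hausdorff_distance X Y * norm x)"
    unfolding abs_mult using t abs_symplectic_support_diff_le[OF X Y] by (intro mult_mono) auto
  moreover have "0 \<le> ?q" by (rule even_gauge_nonneg[OF even_gauge_symplectic_support[OF Y]])
  then have "\<bar>norm x - ?q\<bar> \<le> (C + 1) * norm x" using C[of x] norm_ge_zero[of x]
    by (simp only: abs_le_iff distrib_right) linarith
  then have "\<bar>(t - s) * (norm x - ?q)\<bar> \<le> \<bar>t - s\<bar> * ((C + 1) * norm x)"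
    unfolding abs_mult by (rule mult_left_mono) simp
  moreover have "homotopy_gauge t X x - homotopy_gauge s Y x
      = (1 - t) * (?p - ?q) + (t - s) * (norm x - ?q)"
    by (simp add: homotopy_gauge_def algebra_simps)
  ultimately show ?thesis
    using abs_triangle_ineq[of "(1 - t) * (?p - ?q)" "(t - s) * (norm x - ?q)"]
    by (simp only: distrib_right mult.assoc mult_1)
qed

text \<open>The constants \<open>c\<close>, \<open>R\<close> and \<open>C\<close> all belong to the
  base point \<open>(s, Y)\<close>, so \<open>d\<close> is independent of \<open>X\<close> and
  \<open>t\<close>.\<close>

lemma self_polar_homotopy_close:
  assumes Y: "Y \<in> self_polar_bodies" and s: "0 \<le> s" "s \<le> 1" and e: "e > 0"
  shows "\<exists>d>0. \<forall>X\<in>self_polar_bodies. \<forall>t. 0 \<le> t \<and> t \<le> 1 \<and> \<bar>t - s\<bar> < d \<and> hausdorff_distance Y X < d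
    \<longrightarrow> hausdorff_distance (self_polar_homotopy (s, Y)) (self_polar_homotopy (t, X)) < e"
proof -
  let ?q = "homotopy_gauge s Y"
  have q: "even_gauge ?q" by (rule even_gauge_homotopy_gauge[OF Y s])
  obtain c where c: "c > 0" "\<And>x. c * norm x \<le> ?q x" using even_gauge_lower[OF q] by blast
  obtain R where R: "R > 0" "\<And>x. x \<in> gauge_body (limit_gauge ?q) \<Longrightarrow> norm x \<le> R"
    using bounded_gauge_body[OF even_gauge_limit_gauge[OF q]] by blast
  obtain C where C: "C > 0" "\<And>x. symplectic_support Y x \<le> C * norm x"
    using even_gauge_upper[OF even_gauge_symplectic_support[OF Y]] by blast
  \<comment> \<open>Chosen so that the final Hausdorff bound \<open>(l - 1) * R\<close> equals
    \<open>e / 2\<close>.\<close>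
  define l where "l = 1 + e / (2 * R)"
  have l: "1 < l" using e R by (simp add: l_def)
  \<comment> \<open>The additive error is at most \<open>d + d * (C + 1) = d * (C + 2)\<close>, and
    \<open>d\<close> makes \<open>l\<close> times this equal to \<open>c * (l - 1)\<close>, as
    \<open>gauge_close_imp_ratio\<close> demands.\<close>
  define d where "d = c * (l - 1) / (l * (C + 2))"
  have d: "d > 0" using c l C by (simp add: d_def)
  have "hausdorff_distance (self_polar_homotopy (s, Y)) (self_polar_homotopy (t, X)) < e"
    if X: "X \<in> self_polar_bodies" and t: "0 \<le> t" "t \<le> 1" "\<bar>t - s\<bar> < d" "hausdorff_distance Y X < d" for X t
  proof -
    let ?p = "homotopy_gauge t X"
    let ?r = "hausdorff_distance X Y + \<bar>t - s\<bar> * (C + 1)"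
    have p: "even_gauge ?p" by (rule even_gauge_homotopy_gauge[OF X t(1,2)])
    have "\<bar>t - s\<bar> * (C + 1) \<le> d * (C + 1)" using t C by (intro mult_right_mono) auto
    then have "?r \<le> d * (C + 2)"
      using t(4) by (simp add: hausdorff_distance_commute[of X] algebra_simps)
    then have "l * ?r \<le> l * (d * (C + 2))" using l by (intro mult_left_mono) auto
    also have "\<dots> = c * (l - 1)" using l C by (simp add: d_def)
    finally have lr: "l * ?r \<le> c * (l - 1)" .
    have "0 \<le> ?r" using hausdorff_distance_nonneg[of X Y] C by simp
    then have ratio: "?q x \<le> l * ?p x" "?p x \<le> l * ?q x" for x
      using gauge_close_imp_ratio[OF c _ lr homotopy_gauge_diff_le[OF X Y t(1,2) C(2)]] l by auto
    have "hausdorff_distance (gauge_body (limit_gauge ?q)) (gauge_body (limit_gauge ?p)) \<le> (l - 1) * R"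
      using l p q ratio R(2)
      by (intro hausdorff_distance_gauge_body_le even_gauge_limit_gauge limit_gauge_mono) auto
    also have "\<dots> < e" using R e by (simp add: l_def)
    finally show ?thesis by (simp add: self_polar_homotopy_def)
  qed
  with d show ?thesis by blast
qed

lemma continuous_self_polar_homotopy:
  "continuous_map (prod_topology (top_of_set {0..1}) self_polar_space) self_polar_space
     (self_polar_homotopy :: real \<times> ((real^'n) \<times> (real^'n)) set \<Rightarrow> _)"
proof -
  interpret S: Metric_space "self_polar_bodies :: ((real^'n) \<times> (real^'n)) set set" hausdorff_distance
    by (rule Metric_space_self_polar_bodies)
  show ?thesis
    unfolding self_polar_space_def S.continuous_map_to_metric
  proof (intro ballI allI impI)
    fix z :: "real \<times> ((real^'n) \<times> (real^'n)) set" and e :: real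
    assume z: "z \<in> topspace (prod_topology (top_of_set {0..1}) S.mtopology)" and e: "e > 0"
    obtain s Y where sY: "z = (s, Y)" "0 \<le> s" "s \<le> 1" "Y \<in> self_polar_bodies"
      using z by (cases z) auto
    obtain d where d: "d > 0" "\<And>X t. X \<in> self_polar_bodies \<Longrightarrow> 0 \<le> t \<Longrightarrow> t \<le> 1 \<Longrightarrow> \<bar>t - s\<bar> < d
        \<Longrightarrow> hausdorff_distance Y X < d
        \<Longrightarrow> hausdorff_distance (self_polar_homotopy (s, Y)) (self_polar_homotopy (t, X)) < e"
      using self_polar_homotopy_close[OF sY(4,2,3) e] by blast
    let ?U = "({0..1} \<inter> ball s d) \<times> S.mball Y d"
    have "openin (prod_topology (top_of_set {0..1}) S.mtopology) ?U"
      unfolding openin_prod_Times_iff by (auto intro: openin_open_Int)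
    moreover have "z \<in> ?U" using sY d(1) by simp
    moreover have "\<forall>w\<in>?U. self_polar_homotopy w \<in> S.mball (self_polar_homotopy z) e"
      using sY d(2) by (auto simp: dist_real_def self_polar_homotopy_in abs_minus_commute)
    ultimately show "\<exists>U. openin (prod_topology (top_of_set {0..1}) S.mtopology) U \<and> z \<in> U \<and>
        (\<forall>w\<in>U. self_polar_homotopy w \<in> S.mball (self_polar_homotopy z) e)"
      by blast
  qed
qed

text \<open>The support of \<open>X\<close> is already self-dual, so the iteration fixes it and its
  unit ball is \<open>X\<close>.\<close>

lemma self_polar_homotopy_0:
  assumes "X \<in> self_polar_bodies"
  shows "self_polar_homotopy (0, X) = X"
proof -
  have "homotopy_gauge 0 X = symplectic_support X" by (auto simp: homotopy_gauge_def)
  then show ?thesis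
    using limit_gauge_self_dual[OF self_dual_symplectic_support[OF assms]]
      gauge_body_symplectic_support[OF assms]
    by (simp add: self_polar_homotopy_def)
qed

lemma self_dual_gauge_norm: "self_dual_gauge norm"
  by (simp add: self_dual_gauge_def even_gauge_norm dual_gauge_norm)

lemma self_polar_homotopy_1:
  fixes X :: "((real^'n) \<times> (real^'n)) set"
  shows "self_polar_homotopy (1, X) = gauge_body norm"
proof -
  have "homotopy_gauge 1 X = norm" by (auto simp: homotopy_gauge_def)
  then show ?thesis
    by (simp add: self_polar_homotopy_def limit_gauge_self_dual[OF self_dual_gauge_norm])
qed

theorem theorem1p1:
  shows "topspace (self_polar_space :: ((real^'n) \<times> (real^'n)) set topology) \<noteq> {} \<and>
    contractible_space (self_polar_space :: ((real^'n) \<times> (real^'n)) set topology)"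
proof
  \<comment> \<open>The witness is the Euclidean unit ball, the body to which the homotopy
    contracts.\<close>
  show "topspace (self_polar_space :: ((real^'n) \<times> (real^'n)) set topology) \<noteq> {}"
    unfolding topspace_self_polar_space using gauge_body_self_polar[OF self_dual_gauge_norm] by blast
  let ?S = "self_polar_space :: ((real^'n) \<times> (real^'n)) set topology"
  have "homotopic_with (\<lambda>x. True) ?S ?S id (\<lambda>x. gauge_body norm)"
    using continuous_self_polar_homotopy
    by (subst homotopic_with)
      (auto intro!: exI[of _ self_polar_homotopy]
        simp: topspace_self_polar_space self_polar_homotopy_0 self_polar_homotopy_1)
  then show "contractible_space ?S" unfolding contractible_space_def by blast
qed

end
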